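(* Let $c\in[0,1)$ and $0<W_{\min}\le W_{\max}$. Fix integers $n\ge 1$ and $0\le m<n$, a real $x\ge 0$, and a multiset $P$ of $n$ points in $\mathbb{R}^2$ of which exactly $m$ are at $(0,1)$ and the remaining $n-m$ are at $(x,0)$ or $(-x,0)$. Consider any assignment of weights $w_i\in[W_{\min},W_{\max}]$ to the points of $P$ for which the resulting weighted instance is a COA instance, i.e. $f(P,\hat o,c)=(0,0)$ (for the prediction $\hat o$ under consideration) and $(0,1)$ is an optimal location. Then the approximation ratio $C^u(f(P,\hat o,c),P)/C^u((0,1),P)$ of CMP is at most $$\frac{mW_{\max}+(n-m)xW_{\min}}{(n-m)\sqrt{1+x^2}\,W_{\min}},$$ which is the value obtained when the agents at $(0,1)$ have weight $W_{\max}$ and the agents at $(\pm x,0)$ have weight $W_{\min}$; i.e., this extreme weight distribution maximizes the approximation ratio of CMP among weight distributions on COA instances.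
   Context: Weighted instance: a multiset $P=\{p_1,\dots,p_n\}\subset\mathbb{R}^2$ with weights $w_i>0$; $d$ is Euclidean distance; $C^u(f,P)=\frac1n\sum_i w_i d(f,p_i)$; $o(P)$ is a minimizer of $C^u(\cdot,P)$. The CMP mechanism with confidence $c\in[0,1)$ and prediction $\hat o\in\mathbb{R}^2$: let $m'=\lfloor cn\rfloor$, let $P'$ be $P$ together with $m'$ copies of $\hat o$, and output $f(P,\hat o,c)=(x_{\mathrm{med}},y_{\mathrm{med}})$, where $x_{\mathrm{med}}$ (resp. $y_{\mathrm{med}}$) is the median of the $x$-coordinates (resp. $y$-coordinates) of the $n+m'$ points of $P'$, taking the smaller of the two middle values when $n+m'$ is even. CMP does not use the weights. A (weighted) COA instance is an instance with CMP output $(0,0)$, optimal location $(0,1)$, and all agents located at $(0,1)$, $(x,0)$ or $(-x,0)$ for some $x\ge 0$. *)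

theory Defs
  imports "HOL-Analysis.Analysis"
begin

text \<open>
  A weighted instance consists of points \<open>p 0, \<dots>, p (n - 1)\<close> in the plane (repetitions allowed)
  with weights \<open>w 0, \<dots>, w (n - 1)\<close>; values of \<open>p\<close> and \<open>w\<close> at indices \<open>\<ge> n\<close> are irrelevant.
  On \<open>real \<times> real\<close> the library's \<open>dist\<close> is the Euclidean distance.
\<close>

type_synonym point = "real \<times> real"

definition cost :: "nat \<Rightarrow> (nat \<Rightarrow> real) \<Rightarrow> (nat \<Rightarrow> point) \<Rightarrow> point \<Rightarrow> real" where
  "cost n w p q = (\<Sum>i<n. w i * dist q (p i)) / real n"

definition optimal_location :: "nat \<Rightarrow> (nat \<Rightarrow> real) \<Rightarrow> (nat \<Rightarrow> point) \<Rightarrow> point \<Rightarrow> bool" where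
  "optimal_location n w p q \<longleftrightarrow> (\<forall>q'. cost n w p q \<le> cost n w p q')"

text \<open>For lists of even length this is the smaller of the two middle values.\<close>

definition lower_median :: "real list \<Rightarrow> real" where
  "lower_median xs = sort xs ! ((length xs - 1) div 2)"

definition cmp_points :: "nat \<Rightarrow> (nat \<Rightarrow> point) \<Rightarrow> point \<Rightarrow> real \<Rightarrow> point list" where
  "cmp_points n p o_hat c = map p [0..<n] @ replicate (nat \<lfloor>c * real n\<rfloor>) o_hat"

definition cmp :: "nat \<Rightarrow> (nat \<Rightarrow> point) \<Rightarrow> point \<Rightarrow> real \<Rightarrow> point" where
  "cmp n p o_hat c =
     (lower_median (map fst (cmp_points n p o_hat c)),
      lower_median (map snd (cmp_points n p o_hat c)))"

definition coa_instance ::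
  "nat \<Rightarrow> (nat \<Rightarrow> real) \<Rightarrow> (nat \<Rightarrow> point) \<Rightarrow> point \<Rightarrow> real \<Rightarrow> bool" where
  "coa_instance n w p o_hat c \<longleftrightarrow>
     (\<forall>i<n. w i > 0) \<and>
     cmp n p o_hat c = (0, 0) \<and>
     optimal_location n w p (0, 1) \<and>
     (\<exists>x\<ge>0. \<forall>i<n. p i \<in> {(0, 1), (x, 0), (- x, 0)})"

definition extreme_weights :: "real \<Rightarrow> real \<Rightarrow> (nat \<Rightarrow> point) \<Rightarrow> nat \<Rightarrow> real" where
  "extreme_weights Wmin Wmax p i = (if p i = (0, 1) then Wmax else Wmin)"

end

theory Submission
  imports Defs
begin

text \<open>
  Let \<open>M\<close> and \<open>S\<close> be the total weights of the agents at \<open>(0, 1)\<close> and at \<open>(\<plusminus>x, 0)\<close>. The agents at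
  \<open>(0, 1)\<close> cost nothing at \<open>(0, 1)\<close>, so the ratio equals \<open>(M + x S) / (sqrt (1 + x\<^sup>2) S)\<close>,
  which increases in \<open>M\<close> and decreases in \<open>S\<close>, and the extreme weights maximize \<open>M\<close> and minimize \<open>S\<close>.
  Whether or not \<open>(0, 1)\<close> stays optimal for the extreme weights, an optimal location only
  decreases the denominator. The denominator stays nonzero: cost zero means that all agents
  coincide with the facility, a property independent of the weights, and \<open>(0, 1)\<close> is optimal
  of positive cost for \<open>w\<close>.
\<close>

lemma sum_lessThan_split:
  fixes g :: "nat \<Rightarrow> real"
  shows "sum g {..<n} = sum g {i. i < n \<and> P i} + sum g {i. i < n \<and> \<not> P i}"
proof -
  have "{..<n} = {i. i < n \<and> P i} \<union> {i. i < n \<and> \<not> P i}"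
    by auto
  then show ?thesis
    by (simp add: sum.union_disjoint disjoint_iff)
qed

text \<open>The distances from the origin are 1 and \<bar>x\<bar>, and \<open>0 \<le> x\<close>
  turns the latter into \<open>x\<close>.\<close>

lemma cost_origin_coa:
  assumes "0 \<le> x" and "\<forall>i<n. p i \<noteq> (0, 1) \<longrightarrow> p i = (x, 0) \<or> p i = (- x, 0)"
  shows "cost n w p (0, 0) =
    (sum w {i. i < n \<and> p i = (0, 1)} + x * sum w {i. i < n \<and> p i \<noteq> (0, 1)}) / real n"
proof -
  have "(\<Sum>i | i < n \<and> p i = (0, 1). w i * dist (0, 0) (p i)) = sum w {i. i < n \<and> p i = (0, 1)}"
    by (rule sum.cong) (auto simp: dist_Pair_Pair)
  moreover have "(\<Sum>i | i < n \<and> p i \<noteq> (0, 1). w i * dist (0, 0) (p i)) =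
      (\<Sum>i | i < n \<and> p i \<noteq> (0, 1). x * w i)"
  proof (rule sum.cong)
    fix i assume "i \<in> {i. i < n \<and> p i \<noteq> (0, 1)}"
    then have "p i = (x, 0) \<or> p i = (- x, 0)"
      using assms(2) by auto
    then show "w i * dist (0, 0) (p i) = x * w i"
      using assms(1) by (auto simp: dist_Pair_Pair dist_real_def)
  qed simp
  ultimately show ?thesis
    unfolding cost_def by (subst sum_lessThan_split[where P = "\<lambda>i. p i = (0, 1)"])
      (simp add: sum_distrib_left)
qed

lemma cost_apex_coa:
  assumes "\<forall>i<n. p i \<noteq> (0, 1) \<longrightarrow> p i = (x, 0) \<or> p i = (- x, 0)"
  shows "cost n w p (0, 1) = sqrt (1 + x\<^sup>2) * sum w {i. i < n \<and> p i \<noteq> (0, 1)} / real n"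
proof -
  have "(\<Sum>i | i < n \<and> p i = (0, 1). w i * dist (0, 1) (p i)) = 0"
    by (rule sum.neutral) auto
  moreover have "(\<Sum>i | i < n \<and> p i \<noteq> (0, 1). w i * dist (0, 1) (p i)) =
      (\<Sum>i | i < n \<and> p i \<noteq> (0, 1). sqrt (1 + x\<^sup>2) * w i)"
  proof (rule sum.cong)
    fix i assume "i \<in> {i. i < n \<and> p i \<noteq> (0, 1)}"
    then have "p i = (x, 0) \<or> p i = (- x, 0)"
      using assms by auto
    then show "w i * dist (0, 1) (p i) = sqrt (1 + x\<^sup>2) * w i"
      by (auto simp: dist_Pair_Pair dist_real_def add.commute)
  qed simp
  ultimately show ?thesis
    unfolding cost_def by (subst sum_lessThan_split[where P = "\<lambda>i. p i = (0, 1)"])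
      (simp add: sum_distrib_left)
qed

lemma cost_nonneg:
  assumes "\<forall>i<n. 0 < w i"
  shows "0 \<le> cost n w p q"
  unfolding cost_def using assms
  by (intro divide_nonneg_nonneg sum_nonneg mult_nonneg_nonneg) (auto intro: less_imp_le)

text \<open>A sum of nonnegative terms vanishes only termwise. As the right-hand side is free of
  \<open>w\<close>, vanishing of the cost transfers between weightings. For \<open>n = 0\<close>
  both sides hold, with \<open>0 / 0 = 0\<close>.\<close>

lemma cost_eq_0_iff:
  assumes "\<forall>i<n. 0 < w i"
  shows "cost n w p q = 0 \<longleftrightarrow> (\<forall>i<n. p i = q)"
proof -
  have "(\<Sum>i<n. w i * dist q (p i)) = 0 \<longleftrightarrow> (\<forall>i\<in>{..<n}. w i * dist q (p i) = 0)"
    using assms by (intro sum_nonneg_eq_0_iff) (auto intro: less_imp_le)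
  then show ?thesis
    unfolding cost_def using assms by (cases "n = 0") force+
qed

text \<open>After splitting the fraction, the second summand is \<open>x / s\<close> on both sides,
  so only \<open>M / (s * S)\<close> has to be compared.\<close>

lemma coa_ratio_mono:
  fixes M M' S S' s x :: real
  assumes "M \<le> M'" and "S' \<le> S" and "0 \<le> M'" and "0 < S'" and "0 < s"
  shows "(M + x * S) / (s * S) \<le> (M' + x * S') / (s * S')"
proof -
  have "M / (s * S) \<le> M' / (s * S')"
    using assms by (intro frac_le mult_left_mono) auto
  moreover have "(x * S) / (s * S) = (x * S') / (s * S')"
    using assms by simp
  ultimately show ?thesis
    by (simp add: add_divide_distrib)
qed

theorem theorem3:
  fixes c Wmin Wmax x :: real
    and n m :: nat
    and p :: "nat \<Rightarrow> point"
    and w :: "nat \<Rightarrow> real"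
    and o_hat :: point
  assumes "0 \<le> c" and "c < 1"
    and "0 < Wmin" and "Wmin \<le> Wmax"
    and "1 \<le> n" and "m < n"
    and "0 \<le> x"
    and "card {i. i < n \<and> p i = (0, 1)} = m"
    and "\<forall>i<n. p i \<noteq> (0, 1) \<longrightarrow> p i = (x, 0) \<or> p i = (- x, 0)"
    and "\<forall>i<n. Wmin \<le> w i \<and> w i \<le> Wmax"
    and "coa_instance n w p o_hat c"
  defines "w_ext \<equiv> extreme_weights Wmin Wmax p"
    and "f \<equiv> cmp n p o_hat c"
    and "B \<equiv> (real m * Wmax + real (n - m) * x * Wmin)
             / (real (n - m) * sqrt (1 + x\<^sup>2) * Wmin)"
  shows "cost n w p f / cost n w p (0, 1) \<le> B
    \<and> (\<forall>i<n. Wmin \<le> w_ext i \<and> w_ext i \<le> Wmax)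
    \<and> cost n w_ext p f / cost n w_ext p (0, 1) = B
    \<and> (\<forall>q. optimal_location n w_ext p q \<longrightarrow>
          cost n w p f / cost n w p (0, 1) \<le> cost n w_ext p f / cost n w_ext p q)"
proof -
  define A where "A = {i. i < n \<and> p i = (0, 1)}"
  define R where "R = {i. i < n \<and> p i \<noteq> (0, 1)}"
  define s where "s = sqrt (1 + x\<^sup>2)"
  have n: "0 < real n" and nm: "0 < real (n - m)"
    using assms(5,6) by auto
  have s: "0 < s"
    by (simp add: s_def add_pos_nonneg)
  have cardA: "card A = m"
    using assms(8) by (simp add: A_def)
  have "A \<union> R = {..<n}" "A \<inter> R = {}" "finite A" "finite R"
    by (auto simp: A_def R_def)
  then have cardR: "card R = n - m"
    using card_Un_disjoint[of A R] cardA by simp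
  have f: "f = (0, 0)" and opt: "optimal_location n w p (0, 1)"
    using assms(11) by (auto simp: coa_instance_def f_def)
  have w_pos: "\<forall>i<n. 0 < w i"
    using assms(11) by (simp add: coa_instance_def)
  have ext: "\<forall>i<n. Wmin \<le> w_ext i \<and> w_ext i \<le> Wmax"
    using assms(4) by (auto simp: w_ext_def extreme_weights_def)
  have ext_pos: "\<forall>i<n. 0 < w_ext i"
    using ext assms(3) by fastforce
  \<comment> \<open>CMP ignores the weights, so \<open>f\<close> is the origin for \<open>w\<close>
    and \<open>w_ext\<close> alike; \<open>u\<close> ranges over both.\<close>
  have cost_f: "cost n u p f = (sum u A + x * sum u R) / real n" for u
    using cost_origin_coa[OF assms(7,9)] by (simp add: f A_def R_def)
  have cost_1: "cost n u p (0, 1) = s * sum u R / real n" for u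
    using cost_apex_coa[OF assms(9)] by (simp add: s_def R_def)
  \<comment> \<open>Only \<open>real n\<close> is cancelled, so no condition on
    \<open>sum u R\<close> arises.\<close>
  have ratio: "cost n u p f / cost n u p (0, 1) = (sum u A + x * sum u R) / (s * sum u R)" for u
    using n by (simp add: cost_f cost_1)
  have extA: "sum w_ext A = real m * Wmax"
    using cardA by (simp add: A_def w_ext_def extreme_weights_def)
  have extR: "sum w_ext R = real (n - m) * Wmin"
    using cardR by (simp add: R_def w_ext_def extreme_weights_def)
  have M: "sum w A \<le> real m * Wmax"
    using sum_bounded_above[of A w Wmax] assms(10) cardA by (auto simp: A_def)
  have S: "real (n - m) * Wmin \<le> sum w R"
    using sum_bounded_below[of R Wmin w] assms(10) cardR by (auto simp: R_def)
  have S_pos: "0 < real (n - m) * Wmin"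
    using nm assms(3) by (rule mult_pos_pos)
  have ratio_ext: "cost n w_ext p f / cost n w_ext p (0, 1) = B"
    unfolding ratio extA extR B_def by (simp add: s_def mult_ac)
  have le: "cost n w p f / cost n w p (0, 1) \<le> cost n w_ext p f / cost n w_ext p (0, 1)"
    unfolding ratio extA extR
    \<comment> \<open>The placeholder leaves open the premise that \<open>real m * Wmax\<close> is
      nonnegative.\<close>
    using M S _ S_pos s
    by (rule coa_ratio_mono) (use assms(3,4) in simp)
  have "cost n w p f / cost n w p (0, 1) \<le> cost n w_ext p f / cost n w_ext p q"
    if q: "optimal_location n w_ext p q" for q
  proof -
    \<comment> \<open>Positive since \<open>m < n\<close> leaves some agent away from
      \<open>(0, 1)\<close>.\<close>
    have "0 < cost n w p (0, 1)"
      using s less_le_trans[OF S_pos S] n by (simp add: cost_1)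
    \<comment> \<open>Optimality of \<open>(0, 1)\<close> under \<open>w\<close> enters here: the
      agents cannot all lie at \<open>q\<close>, which also excludes zero cost under
      \<open>w_ext\<close>.\<close>
    also have "\<dots> \<le> cost n w p q"
      using opt unfolding optimal_location_def by blast
    finally have "cost n w_ext p q \<noteq> 0"
      using cost_eq_0_iff[OF w_pos] cost_eq_0_iff[OF ext_pos] by (metis less_irrefl)
    then have "0 < cost n w_ext p q"
      using cost_nonneg[OF ext_pos, of p q] by simp
    moreover have "cost n w_ext p q \<le> cost n w_ext p (0, 1)"
      using q unfolding optimal_location_def by blast
    ultimately have "cost n w_ext p f / cost n w_ext p (0, 1) \<le> cost n w_ext p f / cost n w_ext p q"
      using cost_nonneg[OF ext_pos, of p f] by (intro frac_le) auto
    with le show ?thesis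
      by simp
  qed
  with le ratio_ext ext show ?thesis
    by simp
qed

end
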